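(* In the two-firm baseline model with exogenous price described in the context, under the regularity assumption, define $$D(x)=r\bigl[\eta(2x)-\eta(x)+x\bigl(\eta'(2x)-\eta'(x)\bigr)\bigr]+\frac{r^2}{c_2}\bigl[\eta(2x)\eta'(2x)-\eta(x)\eta'(x)\bigr].$$ Then $$K^*_{\mathrm{NP},1}>K^*_{\mathrm{NF},1}\quad\Longleftrightarrow\quad D(K^*_{\mathrm{NF},1})>0,$$ and $K^*_{\mathrm{NP},1}=K^*_{\mathrm{NF},1}$ if and only if $D(K^*_{\mathrm{NF},1})=0$.
   Context: Parameters: $r>0$ (per-unit revenue), $c_1>0$, $c_2>0$ (capacity cost coefficients), $\delta\in(0,1]$ (discount factor). The learning curve $\eta:[0,\infty)\to[0,\infty)$ is twice continuously differentiable, strictly increasing, strictly concave and bounded, except in the constant-learning benchmark, where $\eta$ is constant; $\eta_{\min}:=\eta(0)$. Model: two symmetric firms choose capacities $K_{i,1}\ge 0$ and $K_{i,2}\ge K_{i,1}$; firm $i$'s profit is $rK_{i,1}\eta_{\min}-\frac{c_1}{2}K_{i,1}^2+\delta[rK_{i,2}\eta(N)-\frac{c_2}{2}(K_{i,2}-K_{i,1})^2]$, where the period-2 learning state is $N=K_{i,1}$ under fragmentation and $N=K_{1,1}+K_{2,1}$ under pooling. Substituting the optimal period-2 capacity gives the following reduced forms, taken as definitions: $$\phi(K,N):=rK\eta(N)+\frac{r^2}{2c_2}\eta(N)^2,$$ $$V_{\mathrm{NF}}(x):=r\eta_{\min}x-\tfrac{c_1}{2}x^2+\delta\phi(x,x),\qquad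 V_{\mathrm{SP}}(x):=r\eta_{\min}x-\tfrac{c_1}{2}x^2+\delta\phi(x,2x),$$ $$V_i^{\mathrm{NP}}(x_i,x_j):=r\eta_{\min}x_i-\tfrac{c_1}{2}x_i^2+\delta\phi(x_i,x_i+x_j).$$ The first-order conditions are $F_{\mathrm{NF}}:=V_{\mathrm{NF}}'$, $F_{\mathrm{SP}}:=V_{\mathrm{SP}}'$, $F_{\mathrm{NP}}(x):=\partial_{x_i}V_i^{\mathrm{NP}}(x_i,x_j)\big|_{x_i=x_j=x}$. Regularity assumption: on the relevant capacity domain, $\eta(N)>0$. The reduced objectives $V_{\mathrm{NF}}$ and $V_{\mathrm{SP}}$ are strictly concave, and $V_i^{\mathrm{NP}}(\cdot,x_j)$ is strictly concave for every relevant $x_j$. The first-order conditions $F_{\mathrm{NF}},F_{\mathrm{NP}},F_{\mathrm{SP}}$ are strictly decreasing and have unique interior roots $x_{\mathrm{NF}},x_{\mathrm{NP}},x_{\mathrm{SP}}\in(0,\infty)$ respectively. (Here "the relevant capacity domain" and "relevant $x_j$" refer to the range of capacities and learning states under consideration in the model; the source does not specify this range further.) Capacities: $K^*_{\mathrm{NF},1}:=x_{\mathrm{NF}}$ (fragmented Nash), $K^*_{\mathrm{NP},1}:=x_{\mathrm{NP}}$ (pooled Nash). *)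

theory Defs
  imports "HOL-Analysis.Analysis"
begin

text \<open>
  Capacities and learning states are nonnegative reals, so learning curves and objectives are
  functions on \<open>{0..}\<close> and their derivatives are taken within \<open>{0..}\<close>: one-sided at \<open>0\<close> and
  the ordinary two-sided derivative at every positive point.
\<close>

definition deriv_nonneg :: "(real \<Rightarrow> real) \<Rightarrow> real \<Rightarrow> real" where
  "deriv_nonneg f x = vector_derivative f (at x within {0..})"

definition twice_continuously_differentiable :: "(real \<Rightarrow> real) \<Rightarrow> bool" where
  "twice_continuously_differentiable f \<longleftrightarrow>
     (\<exists>f' f''. (\<forall>x\<ge>0. (f has_real_derivative f' x) (at x within {0..})) \<and>
               (\<forall>x\<ge>0. (f' has_real_derivative f'' x) (at x within {0..})) \<and>
               continuous_on {0..} f'')"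

definition strictly_concave_on :: "real set \<Rightarrow> (real \<Rightarrow> real) \<Rightarrow> bool" where
  "strictly_concave_on S f \<longleftrightarrow>
     convex S \<and>
     (\<forall>x\<in>S. \<forall>y\<in>S. \<forall>t. x \<noteq> y \<and> 0 < t \<and> t < 1 \<longrightarrow>
        f ((1 - t) * x + t * y) > (1 - t) * f x + t * f y)"

text \<open>The second disjunct below is the constant-learning benchmark.\<close>

definition learning_curve :: "(real \<Rightarrow> real) \<Rightarrow> bool" where
  "learning_curve \<eta> \<longleftrightarrow>
     (\<forall>x\<ge>0. \<eta> x \<ge> 0) \<and>
     (twice_continuously_differentiable \<eta> \<and> strict_mono_on {0..} \<eta> \<and>
        strictly_concave_on {0..} \<eta> \<and> bounded (\<eta> ` {0..})
      \<or> \<eta> constant_on {0..})"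

definition phi :: "real \<Rightarrow> real \<Rightarrow> (real \<Rightarrow> real) \<Rightarrow> real \<Rightarrow> real \<Rightarrow> real" where
  "phi r c2 \<eta> K N = r * K * \<eta> N + r\<^sup>2 / (2 * c2) * (\<eta> N)\<^sup>2"

definition V_NF :: "real \<Rightarrow> real \<Rightarrow> real \<Rightarrow> real \<Rightarrow> (real \<Rightarrow> real) \<Rightarrow> real \<Rightarrow> real" where
  "V_NF r c1 c2 \<delta> \<eta> x = r * \<eta> 0 * x - c1 / 2 * x\<^sup>2 + \<delta> * phi r c2 \<eta> x x"

definition V_SP :: "real \<Rightarrow> real \<Rightarrow> real \<Rightarrow> real \<Rightarrow> (real \<Rightarrow> real) \<Rightarrow> real \<Rightarrow> real" where
  "V_SP r c1 c2 \<delta> \<eta> x = r * \<eta> 0 * x - c1 / 2 * x\<^sup>2 + \<delta> * phi r c2 \<eta> x (2 * x)"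

text \<open>The two capacity arguments are the firm's own capacity and the rival's, in this order.\<close>

definition V_NP :: "real \<Rightarrow> real \<Rightarrow> real \<Rightarrow> real \<Rightarrow> (real \<Rightarrow> real) \<Rightarrow> real \<Rightarrow> real \<Rightarrow> real" where
  "V_NP r c1 c2 \<delta> \<eta> xi xj =
     r * \<eta> 0 * xi - c1 / 2 * xi\<^sup>2 + \<delta> * phi r c2 \<eta> xi (xi + xj)"

definition F_NF :: "real \<Rightarrow> real \<Rightarrow> real \<Rightarrow> real \<Rightarrow> (real \<Rightarrow> real) \<Rightarrow> real \<Rightarrow> real" where
  "F_NF r c1 c2 \<delta> \<eta> = deriv_nonneg (V_NF r c1 c2 \<delta> \<eta>)"

definition F_SP :: "real \<Rightarrow> real \<Rightarrow> real \<Rightarrow> real \<Rightarrow> (real \<Rightarrow> real) \<Rightarrow> real \<Rightarrow> real" where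
  "F_SP r c1 c2 \<delta> \<eta> = deriv_nonneg (V_SP r c1 c2 \<delta> \<eta>)"

definition F_NP :: "real \<Rightarrow> real \<Rightarrow> real \<Rightarrow> real \<Rightarrow> (real \<Rightarrow> real) \<Rightarrow> real \<Rightarrow> real" where
  "F_NP r c1 c2 \<delta> \<eta> x = deriv_nonneg (\<lambda>xi. V_NP r c1 c2 \<delta> \<eta> xi x) x"

text \<open>
  The parameter \<open>X\<close> is the relevant capacity domain, an arbitrary interval of nonnegative
  reals. The relevant learning states are the values of \<open>N\<close> that capacities in \<open>X\<close> generate:
  single capacities under fragmentation and sums of two capacities under pooling.
\<close>

definition interior_root :: "real set \<Rightarrow> (real \<Rightarrow> real) \<Rightarrow> real \<Rightarrow> bool" where
  "interior_root X F x \<longleftrightarrow> x \<in> X \<and> 0 < x \<and> F x = 0"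

definition regularity ::
    "real \<Rightarrow> real \<Rightarrow> real \<Rightarrow> real \<Rightarrow> (real \<Rightarrow> real) \<Rightarrow> real set \<Rightarrow> bool" where
  "regularity r c1 c2 \<delta> \<eta> X \<longleftrightarrow>
     is_interval X \<and> X \<subseteq> {0..} \<and>
     (\<forall>N \<in> X \<union> {x + y | x y. x \<in> X \<and> y \<in> X}. \<eta> N > 0) \<and>
     strictly_concave_on X (V_NF r c1 c2 \<delta> \<eta>) \<and>
     strictly_concave_on X (V_SP r c1 c2 \<delta> \<eta>) \<and>
     (\<forall>xj\<in>X. strictly_concave_on X (\<lambda>xi. V_NP r c1 c2 \<delta> \<eta> xi xj)) \<and>
     strict_antimono_on X (F_NF r c1 c2 \<delta> \<eta>) \<and>
     strict_antimono_on X (F_NP r c1 c2 \<delta> \<eta>) \<and>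
     strict_antimono_on X (F_SP r c1 c2 \<delta> \<eta>) \<and>
     (\<exists>!x. interior_root X (F_NF r c1 c2 \<delta> \<eta>) x) \<and>
     (\<exists>!x. interior_root X (F_NP r c1 c2 \<delta> \<eta>) x) \<and>
     (\<exists>!x. interior_root X (F_SP r c1 c2 \<delta> \<eta>) x)"

definition K_NF :: "real \<Rightarrow> real \<Rightarrow> real \<Rightarrow> real \<Rightarrow> (real \<Rightarrow> real) \<Rightarrow> real set \<Rightarrow> real" where
  "K_NF r c1 c2 \<delta> \<eta> X = (THE x. interior_root X (F_NF r c1 c2 \<delta> \<eta>) x)"

definition K_NP :: "real \<Rightarrow> real \<Rightarrow> real \<Rightarrow> real \<Rightarrow> (real \<Rightarrow> real) \<Rightarrow> real set \<Rightarrow> real" where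
  "K_NP r c1 c2 \<delta> \<eta> X = (THE x. interior_root X (F_NP r c1 c2 \<delta> \<eta>) x)"

definition D :: "real \<Rightarrow> real \<Rightarrow> (real \<Rightarrow> real) \<Rightarrow> real \<Rightarrow> real" where
  "D r c2 \<eta> x =
     r * (\<eta> (2 * x) - \<eta> x + x * (deriv_nonneg \<eta> (2 * x) - deriv_nonneg \<eta> x)) +
     r\<^sup>2 / c2 * (\<eta> (2 * x) * deriv_nonneg \<eta> (2 * x) - \<eta> x * deriv_nonneg \<eta> x)"

end

theory Submission
  imports Defs
begin

text \<open>
  At every \<open>x > 0\<close> the two first-order conditions differ by \<open>F_NP x - F_NF x = \<delta> * D x\<close>.
  At the fragmented equilibrium \<open>F_NF\<close> vanishes, so \<open>D\<close> has there the sign of \<open>F_NP\<close>; as \<open>F_NP\<close>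
  is strictly decreasing, that sign tells on which side its root lies.
\<close>

lemma at_within_nonneg:
  fixes x :: real
  assumes "x > 0"
  shows "at x within {0..} = at x"
  by (rule at_within_open_subset[of x "{0<..}"]) (use assms in auto)

lemma deriv_nonneg_eq:
  assumes "(f has_real_derivative d) (at x)" and "x > 0"
  shows "deriv_nonneg f x = d"
proof -
  have "(f has_vector_derivative d) (at x)"
    using assms(1) by (simp only: has_real_derivative_iff_has_vector_derivative)
  then show ?thesis
    unfolding deriv_nonneg_def at_within_nonneg[OF assms(2)] by (rule vector_derivative_at)
qed

text \<open>\<open>vector_derivative\<close> is a choice operator, so
  \<open>deriv_nonneg \<eta> x\<close> is the slope only once some derivative is known to exist.
  Smooth and constant curves need separate arguments.\<close>

lemma learning_curve_has_derivative:
  assumes "learning_curve \<eta>" and "x > 0"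
  shows "(\<eta> has_real_derivative deriv_nonneg \<eta> x) (at x)"
proof -
  have "\<exists>d. (\<eta> has_real_derivative d) (at x)"
  proof (cases "\<eta> constant_on {0..}")
    case True
    then obtain c where c: "\<And>y. y \<ge> 0 \<Longrightarrow> \<eta> y = c"
      by (auto simp: constant_on_def)
    \<comment> \<open>Negative arguments are unconstrained, so \<open>\<eta>\<close> is compared
      with the constant only on the open set \<open>{0<..}\<close> around \<open>x\<close>.\<close>
    have "(\<eta> has_real_derivative 0) (at x)"
      by (rule has_field_derivative_transform_within_open[of "\<lambda>_. c" 0 x "{0<..}"])
        (use c assms(2) in auto)
    then show ?thesis ..
  next
    case False
    then obtain d where "(\<eta> has_real_derivative d) (at x within {0..})"
      using assms less_imp_le unfolding learning_curve_def twice_continuously_differentiable_def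
      by blast
    then show ?thesis
      using at_within_nonneg[OF assms(2)] by auto
  qed
  then show ?thesis
    using deriv_nonneg_eq assms(2) by blast
qed

text \<open>Leaving the curve \<open>g\<close> arbitrary serves both regimes: \<open>g\<close> is
  \<open>\<eta>\<close> itself under fragmentation, and \<open>\<eta>\<close> shifted by the rival's
  capacity under pooling.\<close>

lemma DERIV_objective:
  assumes "(g has_real_derivative d) (at x)"
  shows "((\<lambda>y. m * y - c / 2 * y\<^sup>2 + \<delta> * phi r c2 g y y)
    has_real_derivative m - c * x + \<delta> * (r * (g x + x * d) + r\<^sup>2 / c2 * (g x * d))) (at x)"
  unfolding phi_def
  by (rule derivative_eq_intros assms refl)+ (simp add: algebra_simps)

lemma F_NF_eq:
  assumes "learning_curve \<eta>" and "x > 0"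
  shows "F_NF r c1 c2 \<delta> \<eta> x = r * \<eta> 0 - c1 * x +
    \<delta> * (r * (\<eta> x + x * deriv_nonneg \<eta> x) + r\<^sup>2 / c2 * (\<eta> x * deriv_nonneg \<eta> x))"
  unfolding F_NF_def V_NF_def[abs_def]
  by (rule deriv_nonneg_eq[OF DERIV_objective \<open>x > 0\<close>])
    (rule learning_curve_has_derivative[OF assms])

lemma F_NP_eq:
  assumes "learning_curve \<eta>" and "x > 0"
  shows "F_NP r c1 c2 \<delta> \<eta> x = r * \<eta> 0 - c1 * x +
    \<delta> * (r * (\<eta> (2 * x) + x * deriv_nonneg \<eta> (2 * x)) +
         r\<^sup>2 / c2 * (\<eta> (2 * x) * deriv_nonneg \<eta> (2 * x)))"
proof -
  \<comment> \<open>The rival's capacity is frozen at \<open>x\<close>, so only the own contribution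
    to the learning state varies: the slope at \<open>x\<close> is that of \<open>\<eta>\<close> at
    \<open>2 * x\<close>, without the chain-rule factor 2 of joint planning.\<close>
  let ?g = "\<lambda>y. \<eta> (y + x)"
  have "(\<eta> has_real_derivative deriv_nonneg \<eta> (x + x)) (at (x + x))"
    using learning_curve_has_derivative[of \<eta> "x + x"] assms by simp
  then have "(?g has_real_derivative deriv_nonneg \<eta> (2 * x)) (at x)"
    unfolding mult_2 by (rule DERIV_shift[THEN iffD1])
  from deriv_nonneg_eq[OF DERIV_objective[OF this] \<open>x > 0\<close>, of "r * \<eta> 0" c1 \<delta> r c2]
  show ?thesis
    by (simp add: F_NP_def V_NP_def phi_def)
qed

lemma F_NP_minus_F_NF:
  assumes "learning_curve \<eta>" and "x > 0"
  shows "F_NP r c1 c2 \<delta> \<eta> x - F_NF r c1 c2 \<delta> \<eta> x = \<delta> * D r c2 \<eta> x"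
  by (simp add: F_NP_eq[OF assms] F_NF_eq[OF assms] D_def algebra_simps)

theorem proposition3:
  fixes r c1 c2 \<delta> :: real and \<eta> :: "real \<Rightarrow> real" and X :: "real set"
  assumes "r > 0" and "c1 > 0" and "c2 > 0" and "0 < \<delta>" and "\<delta> \<le> 1"
    and "learning_curve \<eta>"
    and "regularity r c1 c2 \<delta> \<eta> X"
  shows "(K_NP r c1 c2 \<delta> \<eta> X > K_NF r c1 c2 \<delta> \<eta> X \<longleftrightarrow> D r c2 \<eta> (K_NF r c1 c2 \<delta> \<eta> X) > 0) \<and>
         (K_NP r c1 c2 \<delta> \<eta> X = K_NF r c1 c2 \<delta> \<eta> X \<longleftrightarrow> D r c2 \<eta> (K_NF r c1 c2 \<delta> \<eta> X) = 0)"
proof -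
  define a where "a = K_NF r c1 c2 \<delta> \<eta> X"
  define b where "b = K_NP r c1 c2 \<delta> \<eta> X"
  let ?F = "F_NP r c1 c2 \<delta> \<eta>"
  have "\<exists>!x. interior_root X (F_NF r c1 c2 \<delta> \<eta>) x" and "\<exists>!x. interior_root X ?F x"
    and anti: "strict_antimono_on X ?F"
    using assms(7) unfolding regularity_def by blast+
  then have "interior_root X (F_NF r c1 c2 \<delta> \<eta>) a" and "interior_root X ?F b"
    unfolding a_def b_def K_NF_def K_NP_def by (blast intro: theI')+
  then have a: "a \<in> X" "a > 0" "F_NF r c1 c2 \<delta> \<eta> a = 0" and b: "b \<in> X" "?F b = 0"
    by (auto simp: interior_root_def)
  have Fa: "?F a = \<delta> * D r c2 \<eta> a"
    using F_NP_minus_F_NF[of \<eta> a r c1 c2 \<delta>] assms a by simp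
  have "a < b \<Longrightarrow> ?F a > 0" and "b < a \<Longrightarrow> ?F a < 0"
    using anti a(1) b by (fastforce simp: monotone_on_def)+
  \<comment> \<open>The three orderings of \<open>a\<close> and \<open>b\<close> force three
    mutually exclusive signs of \<open>?F a\<close>, so each implication reverses.\<close>
  then have "b > a \<longleftrightarrow> ?F a > 0" and "b = a \<longleftrightarrow> ?F a = 0"
    using b(2) by (cases a b rule: linorder_cases; simp)+
  then show ?thesis
    using \<open>0 < \<delta>\<close> Fa unfolding a_def b_def by (simp add: zero_less_mult_iff)
qed

end
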